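(* Let $n\ge1$, let $\mathcal{C}\subset\mathbb{H}^n$ be a convex set, let $f:\mathcal{C}\to\mathbb{R}$, and let $\sigma>0$. Then $f$ is $\sigma$-strongly convex if and only if the function $g:\mathcal{C}\to\mathbb{R}$, $$g(\boldsymbol{q})= f(\boldsymbol{q})-\frac{\sigma}{2}\|\boldsymbol{q}\|_2^2,$$ is convex.
   Context: $\mathbb{H}$ is the algebra of real quaternions; for $\boldsymbol{q}\in\mathbb{H}^n$, $\|\boldsymbol{q}\|_2=\sqrt{\boldsymbol{q}^{\mathsf{H}}\boldsymbol{q}}$, with $(\cdot)^{\mathsf{H}}$ the conjugate transpose. A set $\mathcal{C}\subset\mathbb{H}^n$ is convex if $\theta\boldsymbol{x}+(1-\theta)\boldsymbol{y}\in\mathcal{C}$ for all $\boldsymbol{x},\boldsymbol{y}\in\mathcal{C}$ and real $0\le\theta\le1$. $g:\mathcal{C}\to\mathbb{R}$ is convex if $\mathcal{C}$ is convex and $g(\theta\boldsymbol{x}+(1-\theta)\boldsymbol{y})\le\theta g(\boldsymbol{x})+(1-\theta)g(\boldsymbol{y})$ for all $\boldsymbol{x},\boldsymbol{y}\in\mathcal{C}$, $0\le\theta\le1$. For $\sigma>0$, $f:\mathcal{C}\to\mathbb{R}$ is $\sigma$-strongly convex if for all $\boldsymbol{p},\boldsymbol{q}\in\mathcal{C}$ and $\theta\in(0,1)$, $$f(\theta\boldsymbol{p}+(1-\theta)\boldsymbol{q})\le\theta f(\boldsymbol{p})+(1-\theta)f(\boldsymbol{q})-\frac{\sigma}{2}\theta(1-\theta)\|\boldsymbol{p}-\boldsymbol{q}\|_2^2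 .$$ *)

theory Defs
  imports "HOL-Analysis.Analysis"
begin

section \<open>The algebra of real quaternions\<close>

text \<open>\<open>Quat a b c d\<close> is $a + bi + cj + dk$.\<close>

datatype quat = Quat (qRe: real) (qIm1: real) (qIm2: real) (qIm3: real)

lemma quat_eq_iff:
  "x = y \<longleftrightarrow> qRe x = qRe y \<and> qIm1 x = qIm1 y \<and> qIm2 x = qIm2 y \<and> qIm3 x = qIm3 y"
  by (cases x; cases y) simp

instantiation quat :: real_algebra_1
begin

definition zero_quat :: quat where "0 = Quat 0 0 0 0"

definition one_quat :: quat where "1 = Quat 1 0 0 0"

definition plus_quat :: "quat \<Rightarrow> quat \<Rightarrow> quat" where
  "x + y = Quat (qRe x + qRe y) (qIm1 x + qIm1 y) (qIm2 x + qIm2 y) (qIm3 x + qIm3 y)"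

definition uminus_quat :: "quat \<Rightarrow> quat" where
  "- x = Quat (- qRe x) (- qIm1 x) (- qIm2 x) (- qIm3 x)"

definition minus_quat :: "quat \<Rightarrow> quat \<Rightarrow> quat" where
  "x - y = Quat (qRe x - qRe y) (qIm1 x - qIm1 y) (qIm2 x - qIm2 y) (qIm3 x - qIm3 y)"

definition scaleR_quat :: "real \<Rightarrow> quat \<Rightarrow> quat" where
  "r *\<^sub>R x = Quat (r * qRe x) (r * qIm1 x) (r * qIm2 x) (r * qIm3 x)"

definition times_quat :: "quat \<Rightarrow> quat \<Rightarrow> quat" where
  "x * y = Quat
     (qRe x * qRe y - qIm1 x * qIm1 y - qIm2 x * qIm2 y - qIm3 x * qIm3 y)
     (qRe x * qIm1 y + qIm1 x * qRe y + qIm2 x * qIm3 y - qIm3 x * qIm2 y)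
     (qRe x * qIm2 y - qIm1 x * qIm3 y + qIm2 x * qRe y + qIm3 x * qIm1 y)
     (qRe x * qIm3 y + qIm1 x * qIm2 y - qIm2 x * qIm1 y + qIm3 x * qRe y)"

instance
  by standard
    (simp_all add: zero_quat_def one_quat_def plus_quat_def uminus_quat_def minus_quat_def
      scaleR_quat_def times_quat_def algebra_simps)

end

lemma quat_units:
  defines "i \<equiv> Quat 0 1 0 0" and "j \<equiv> Quat 0 0 1 0" and "k \<equiv> Quat 0 0 0 1"
  shows "i * i = -1" "j * j = -1" "k * k = -1" "i * j * k = -1"
  by (simp_all add: i_def j_def k_def times_quat_def one_quat_def uminus_quat_def)

lemma of_real_quat: "of_real r = Quat r 0 0 0"
  by (simp add: of_real_def scaleR_quat_def one_quat_def)

definition qcnj :: "quat \<Rightarrow> quat" where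
  "qcnj x = Quat (qRe x) (- qIm1 x) (- qIm2 x) (- qIm3 x)"

lemma qcnj_mult_self:
  "qcnj x * x = of_real ((qRe x)\<^sup>2 + (qIm1 x)\<^sup>2 + (qIm2 x)\<^sup>2 + (qIm3 x)\<^sup>2)"
  by (simp add: qcnj_def times_quat_def of_real_quat power2_eq_square)


section \<open>The norm on quaternionic vectors\<close>

text \<open>The product $p^{\mathsf H} q$ of the row vector $p^{\mathsf H}$ and the column vector $q$.\<close>

definition qinner :: "quat ^ 'n::finite \<Rightarrow> quat ^ 'n \<Rightarrow> quat" where
  "qinner p q = (\<Sum>i\<in>UNIV. qcnj (p $ i) * q $ i)"

text \<open>$q^{\mathsf H} q$ is a quaternion; it is real and nonnegative by \<open>qinner_self\<close> below,
  so taking \<open>qRe\<close> only changes its type.\<close>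

definition qnorm :: "quat ^ 'n::finite \<Rightarrow> real" where
  "qnorm q = sqrt (qRe (qinner q q))"

lemma qinner_self:
  "qinner q q =
    of_real (\<Sum>i\<in>UNIV. (qRe (q $ i))\<^sup>2 + (qIm1 (q $ i))\<^sup>2 + (qIm2 (q $ i))\<^sup>2 + (qIm3 (q $ i))\<^sup>2)"
  by (simp only: qinner_def qcnj_mult_self of_real_sum)

lemma of_real_qnorm_square: "of_real ((qnorm q)\<^sup>2) = qinner q q"
proof -
  have "0 \<le> qRe (qinner q q)"
    by (simp add: qinner_self of_real_quat sum_nonneg del: of_real_sum)
  then have "(qnorm q)\<^sup>2 = qRe (qinner q q)"
    by (simp add: qnorm_def)
  then show ?thesis
    by (simp add: qinner_self of_real_quat del: of_real_sum)
qed


section \<open>Strong convexity\<close>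

text \<open>A function on \<open>C\<close> is a total function of which only the values on \<open>C\<close> matter. The definition is meant
  for convex \<open>C\<close>; otherwise it would involve values outside \<open>C\<close>.\<close>

definition strongly_convex_on ::
    "real \<Rightarrow> (quat ^ 'n::finite) set \<Rightarrow> (quat ^ 'n \<Rightarrow> real) \<Rightarrow> bool" where
  "strongly_convex_on \<sigma> C f \<longleftrightarrow>
    (\<forall>p\<in>C. \<forall>q\<in>C. \<forall>\<theta>\<in>{0<..<1}.
      f (\<theta> *\<^sub>R p + (1 - \<theta>) *\<^sub>R q)
        \<le> \<theta> * f p + (1 - \<theta>) * f q - \<sigma> / 2 * \<theta> * (1 - \<theta>) * (qnorm (p - q))\<^sup>2)"

end

theory Submission
  imports Defs
begin

text \<open>
  On a real inner product space the squared norm satisfies, along a segment,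
  \[ \|\theta p + (1-\theta) q\|^2 = \theta\|p\|^2 + (1-\theta)\|q\|^2 - \theta(1-\theta)\|p-q\|^2, \]
  so it meets the strong convexity inequality with equality, at modulus $2$. The quaternionic
  norm is the Euclidean norm of the $4n$ real coordinates, hence obeys this identity
  (\<open>qnorm_square_convex_combination\<close>). Subtracting $\sigma/2$ times it from the
  strong convexity inequality for $f$ cancels the quadratic term exactly and leaves the
  convexity inequality for $f - \frac{\sigma}{2}\|\cdot\|^2$; the two inequalities are thus
  equivalent for each triple $p$, $q$, $\theta$ separately.
\<close>

lemma qnorm_square:
  "(qnorm q)\<^sup>2 =
    (\<Sum>i\<in>UNIV. (qRe (q $ i))\<^sup>2 + (qIm1 (q $ i))\<^sup>2 + (qIm2 (q $ i))\<^sup>2 + (qIm3 (q $ i))\<^sup>2)"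
  using of_real_qnorm_square[of q] unfolding qinner_self of_real_eq_iff .

text \<open>Since noncommutativity never enters once the square is written in real coordinates, this is
  a polynomial identity in each coordinate, summed over all of them.\<close>

lemma qnorm_square_convex_combination:
  "(qnorm (\<theta> *\<^sub>R p + (1 - \<theta>) *\<^sub>R q))\<^sup>2
    = \<theta> * (qnorm p)\<^sup>2 + (1 - \<theta>) * (qnorm q)\<^sup>2 - \<theta> * (1 - \<theta>) * (qnorm (p - q))\<^sup>2"
proof -
  have coordinate: "(\<theta> * x + (1 - \<theta>) * y)\<^sup>2 = \<theta> * x\<^sup>2 + (1 - \<theta>) * y\<^sup>2 - \<theta> * (1 - \<theta>) * (x - y)\<^sup>2"
    for x y :: real
    by (simp add: power2_eq_square algebra_simps)
  show ?thesis
    unfolding qnorm_square sum_distrib_left sum.distrib[symmetric] sum_subtractf[symmetric]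
    by (rule sum.cong[OF refl])
      (simp add: plus_quat_def minus_quat_def scaleR_quat_def coordinate distrib_left)
qed

theorem mainTheorem3:
  fixes C :: "(quat ^ 'n::finite) set"
    and f :: "quat ^ 'n \<Rightarrow> real"
    and \<sigma> :: real
  assumes "convex C"
    and "\<sigma> > 0"
  shows "strongly_convex_on \<sigma> C f \<longleftrightarrow> convex_on C (\<lambda>q. f q - \<sigma> / 2 * (qnorm q)\<^sup>2)"
proof -
  let ?g = "\<lambda>q. f q - \<sigma> / 2 * (qnorm q)\<^sup>2"
  have pointwise: "?g (\<theta> *\<^sub>R p + (1 - \<theta>) *\<^sub>R q) \<le> \<theta> * ?g p + (1 - \<theta>) * ?g q \<longleftrightarrow>
      f (\<theta> *\<^sub>R p + (1 - \<theta>) *\<^sub>R q)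
        \<le> \<theta> * f p + (1 - \<theta>) * f q - \<sigma> / 2 * \<theta> * (1 - \<theta>) * (qnorm (p - q))\<^sup>2"
    for p q \<theta>
  proof -
    have "\<theta> * ?g p + (1 - \<theta>) * ?g q - ?g (\<theta> *\<^sub>R p + (1 - \<theta>) *\<^sub>R q)
        = \<theta> * f p + (1 - \<theta>) * f q - \<sigma> / 2 * \<theta> * (1 - \<theta>) * (qnorm (p - q))\<^sup>2
          - f (\<theta> *\<^sub>R p + (1 - \<theta>) *\<^sub>R q)"
      unfolding qnorm_square_convex_combination by algebra
    then show ?thesis
      by linarith
  qed
  show ?thesis
  proof
    assume strong: "strongly_convex_on \<sigma> C f"
    show "convex_on C ?g"
    proof (rule convex_onI)
      fix t :: real and x y :: "quat ^ 'n"
      assume "0 < t" "t < 1" "x \<in> C" "y \<in> C"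
      then have "?g (t *\<^sub>R y + (1 - t) *\<^sub>R x) \<le> t * ?g y + (1 - t) * ?g x"
        unfolding pointwise using strong by (simp add: strongly_convex_on_def)
      then show "?g ((1 - t) *\<^sub>R x + t *\<^sub>R y) \<le> (1 - t) * ?g x + t * ?g y"
        by (simp only: add.commute)
    qed (rule \<open>convex C\<close>)
  next
    assume cvx: "convex_on C ?g"
    show "strongly_convex_on \<sigma> C f"
      unfolding strongly_convex_on_def pointwise[symmetric]
      using cvx by (auto simp: convex_on_def)
  qed
qed

end
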